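(* Let $n\ge 1$ and $\lambda\in[1/(n+1),1/2]$. For every polytope $P\subseteq\mathbb{R}^n$ which is not $\lambda$-vertex generated there exists $\varepsilon>0$ such that if $Q\subseteq\mathbb{R}^n$ is a polytope with $d_F(P,Q)<\varepsilon$, then $Q$ is not $\lambda$-vertex generated. Equivalently, for polytopes $P,(P_m)_{m=1}^\infty$ in $\mathbb{R}^n$, if $P_m\in\mathrm{VG}(\mathbb{R}^n,\lambda)$ for all $m$ and $d_F(P_m,P)\to 0$, then $P\in\mathrm{VG}(\mathbb{R}^n,\lambda)$.
   Context: A polytope in $\mathbb{R}^n$ is the convex hull of a finite non-empty set of points; $V(P)$ denotes the set of vertices of $P$; $A+B=\{a+b: a\in A,b\in B\}$ is the Minkowski sum. For a polytope $P\subset\mathbb{R}^n$ let $\lambda(P)=\sup\{\lambda\in\mathbb{R}: P=(1-\lambda)P+\lambda V(P)\}$ (value in $(-\infty,+\infty]$; it is $+\infty$ exactly when $P$ is a single point). $P$ is called $\lambda$-vertex generated if $\lambda(P)\ge\lambda$, and $\mathrm{VG}(\mathbb{R}^n,\lambda)$ is the class of $\lambda$-vertex generated polytopes in $\mathbb{R}^n$. For polytopes $P,Q\subseteq\mathbb{R}^n$, $d_F(P,Q)=d_H(V(P),V(Q))$, where $d_H$ is the Hausdorff distance (with respect to the Euclidean norm) between non-empty compact sets. *)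

theory Defs
  imports "HOL-Analysis.Analysis" "HOL-Library.Set_Algebras" "HOL-Library.Extended_Real"
begin

(* The library's polytope admits the empty set; here polytopes are non-empty. *)
definition is_polytope :: "'a::real_vector set \<Rightarrow> bool" where
  "is_polytope P \<longleftrightarrow> polytope P \<and> P \<noteq> {}"

definition vertices :: "'a::real_vector set \<Rightarrow> 'a set" where
  "vertices P = {v. v extreme_point_of P}"

(* P = (1 - c) P + c V(P), where + on sets is the Minkowski sum of Set_Algebras.
   The supremum is over all real c (c = 0 always qualifies when P is a polytope), taken
   in the extended reals because it is infinite when P is a single point. *)
definition vg_lambda :: "'a::real_vector set \<Rightarrow> ereal" where
  "vg_lambda P =
     Sup {ereal c | c::real. P = (\<lambda>x. (1 - c) *\<^sub>R x) ` P + (\<lambda>x. c *\<^sub>R x) ` vertices P}"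

definition vertex_generated :: "real \<Rightarrow> 'a::real_vector set \<Rightarrow> bool" where
  "vertex_generated l P \<longleftrightarrow> vg_lambda P \<ge> ereal l"

definition VG :: "real \<Rightarrow> 'a::real_vector set set" where
  "VG l = {P. is_polytope P \<and> vertex_generated l P}"

(* Meaningful for non-empty bounded sets, where both suprema are of non-empty sets
   bounded above. *)
definition hausdorff_dist :: "'a::metric_space set \<Rightarrow> 'a set \<Rightarrow> real" where
  "hausdorff_dist A B = max (SUP a\<in>A. infdist a B) (SUP b\<in>B. infdist b A)"

definition d_F :: "'a::real_normed_vector set \<Rightarrow> 'a set \<Rightarrow> real" where
  "d_F P Q = hausdorff_dist (vertices P) (vertices Q)"

end

(*
  Write K_c(P) = (1 - c) P + c V(P).  For 0 <= c <= 1 convexity gives K_c(P) \<subseteq> P, and K_c(P)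
  decreases in c; since K_c(P) is compact and depends Lipschitz-continuously on c, a polytope is
  c-vertex generated iff P \<subseteq> K_c(P), i.e. the supremum is attained.  If V(Q) is e-close to V(P), then
  Q = conv V(Q) is e-close to P and K_c(Q) is e-close to K_c(P), so P \<subseteq> K_c(P) follows by
  letting e tend to 0.
*)
theory Submission
  imports Defs
begin

text \<open>This is K_c(P) from the overview: \<open>vg_lambda P\<close> is the supremum of the real
  c with \<open>P = vertex_mix c P\<close>.\<close>

definition vertex_mix :: "real \<Rightarrow> 'a::real_vector set \<Rightarrow> 'a set" where
  "vertex_mix c P = (\<lambda>x. (1 - c) *\<^sub>R x) ` P + (\<lambda>x. c *\<^sub>R x) ` vertices P"

lemma vertex_mixI:
  "p \<in> P \<Longrightarrow> v \<in> vertices P \<Longrightarrow> (1 - c) *\<^sub>R p + c *\<^sub>R v \<in> vertex_mix c P"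
  unfolding vertex_mix_def by (blast intro: set_plus_intro)

lemma vertex_mixE:
  assumes "x \<in> vertex_mix c P"
  obtains p v where "p \<in> P" "v \<in> vertices P" "x = (1 - c) *\<^sub>R p + c *\<^sub>R v"
  using assms unfolding vertex_mix_def set_plus_def by blast

lemma vertices_subset: "vertices P \<subseteq> P"
  by (auto simp: vertices_def extreme_point_of_def)

lemma vertex_mix_subset:
  assumes "convex P" "0 \<le> c" "c \<le> 1"
  shows "vertex_mix c P \<subseteq> P"
proof
  fix x assume "x \<in> vertex_mix c P"
  then obtain p v where "p \<in> P" "v \<in> vertices P" "x = (1 - c) *\<^sub>R p + c *\<^sub>R v"
    by (rule vertex_mixE)
  then show "x \<in> P"
    using assms vertices_subset[of P] by (auto intro!: convexD)
qed

lemma is_polytope_facts: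
  fixes P :: "'a::euclidean_space set"
  assumes "is_polytope P"
  shows "convex P" "compact P" "finite (vertices P)" "vertices P \<noteq> {}"
    "P = convex hull (vertices P)"
proof -
  have P: "polytope P" "P \<noteq> {}"
    using assms by (auto simp: is_polytope_def)
  show c: "convex P" "compact P"
    using P by (auto intro: polytope_imp_convex polytope_imp_compact)
  show "finite (vertices P)"
    unfolding vertices_def by (intro finite_polyhedron_extreme_points polytope_imp_polyhedron P)
  show h: "P = convex hull (vertices P)"
    unfolding vertices_def using Krein_Milman_Minkowski[OF c(2,1)] .
  show "vertices P \<noteq> {}"
    using h P by auto
qed

lemma compact_vertex_mix:
  fixes P :: "'a::euclidean_space set"
  assumes "is_polytope P"
  shows "compact (vertex_mix c P)"
proof -
  have "vertex_mix c P = {x + y |x y. x \<in> (\<lambda>x. (1 - c) *\<^sub>R x) ` P \<and>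
      y \<in> (\<lambda>x. c *\<^sub>R x) ` vertices P}"
    unfolding vertex_mix_def set_plus_def by blast
  moreover have "compact \<dots>"
    by (intro compact_sums compact_scaling finite_imp_compact is_polytope_facts[OF assms])
  ultimately show ?thesis
    by simp
qed

text \<open>The supremum ranges over all reals, so c > 1 must be covered. A point p of
  \<open>P\<close> other than v would give a point w of \<open>P\<close> on the ray from p through v
  but beyond v. Then v lies strictly between p and w, at parameter 1/c, against extremality.\<close>

lemma vertex_mix_gt_one_imp_singleton:
  assumes "vertex_mix c P \<subseteq> P" "1 < c" "v \<in> vertices P"
  shows "P = {v}"
proof -
  have "p = v" if p: "p \<in> P" for p
  proof (rule ccontr)
    assume "p \<noteq> v"
    define w where "w = (1 - c) *\<^sub>R p + c *\<^sub>R v"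
    have "w \<in> P"
      using assms p unfolding w_def by (blast intro: vertex_mixI)
    have "w - p = c *\<^sub>R (v - p)"
      by (simp add: w_def algebra_simps)
    then have v: "v = (1 - 1/c) *\<^sub>R p + (1/c) *\<^sub>R w" and "p \<noteq> w"
      using \<open>1 < c\<close> \<open>p \<noteq> v\<close> by (auto simp: w_def algebra_simps)
    then have "v \<in> open_segment p w"
      using \<open>1 < c\<close> unfolding in_segment by (intro conjI exI[of _ "1/c"]) auto
    then show False
      using assms(3) p \<open>w \<in> P\<close> by (auto simp: vertices_def extreme_point_of_def)
  qed
  then show ?thesis
    using assms(3) vertices_subset by blast
qed

text \<open>The surplus (d - c) v is moved into the summand from \<open>P\<close>: as (1 - d) + (d -
  c) = 1 - c, convexity absorbs it after division by 1 - c. The case c = 1 forces d = c.\<close>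

lemma vertex_mix_antimono:
  assumes "convex P" "0 \<le> c" "c \<le> d" "d \<le> 1"
  shows "vertex_mix d P \<subseteq> vertex_mix c P"
proof (cases "c = 1")
  case False
  then have c: "c < 1"
    using assms by auto
  show ?thesis
  proof
    fix x assume "x \<in> vertex_mix d P"
    then obtain p v where x: "p \<in> P" "v \<in> vertices P" "x = (1 - d) *\<^sub>R p + d *\<^sub>R v"
      by (rule vertex_mixE)
    define q where "q = ((1 - d) / (1 - c)) *\<^sub>R p + ((d - c) / (1 - c)) *\<^sub>R v"
    have "q \<in> P"
      unfolding q_def using x assms c vertices_subset[of P]
      by (intro convexD) (auto simp: field_simps)
    moreover have "(1 - c) *\<^sub>R q = (1 - d) *\<^sub>R p + (d - c) *\<^sub>R v"
      using c by (simp add: q_def scaleR_right_distrib)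
    then have "x = (1 - c) *\<^sub>R q + c *\<^sub>R v"
      by (simp add: x algebra_simps)
    ultimately show "x \<in> vertex_mix c P"
      using x by (simp add: vertex_mixI)
  qed
qed (use assms in auto)

text \<open>Turns approximation into membership; both limit arguments below end this way.\<close>

lemma subset_closedI:
  fixes K :: "'a::metric_space set"
  assumes "closed K" "\<And>x e. x \<in> P \<Longrightarrow> 0 < e \<Longrightarrow> \<exists>y\<in>K. dist x y < e"
  shows "P \<subseteq> K"
  using assms by (metis closed_approachable dist_commute subsetI)

text \<open>The supremum is attained: admissible c close to l from below give points of
  \<open>vertex_mix l P\<close> arbitrarily near x, and this set is closed.\<close>

lemma vertex_generated_iff:
  fixes P :: "'a::euclidean_space set"
  assumes P: "is_polytope P" and l: "0 \<le> l" "l \<le> 1"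
  shows "vertex_generated l P \<longleftrightarrow> P \<subseteq> vertex_mix l P"
proof
  note facts = is_polytope_facts[OF P]
  assume "P \<subseteq> vertex_mix l P"
  then have "P = vertex_mix l P"
    using vertex_mix_subset[OF facts(1) l] by blast
  then show "vertex_generated l P"
    unfolding vertex_generated_def vg_lambda_def
    by (intro Sup_upper) (auto simp: vertex_mix_def)
next
  note facts = is_polytope_facts[OF P]
  assume vg: "vertex_generated l P"
  obtain D where D: "D > 0" "\<And>p v. p \<in> P \<Longrightarrow> v \<in> P \<Longrightarrow> dist p v \<le> D"
    using compact_imp_bounded[OF facts(2)] unfolding bounded_two_points
    by (metis dual_order.strict_trans1 gt_ex linorder_le_cases order_trans zero_less_one)
  show "P \<subseteq> vertex_mix l P"
  proof (rule subset_closedI)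
    show "closed (vertex_mix l P)"
      by (intro compact_imp_closed compact_vertex_mix P)
    fix x and e :: real
    assume x: "x \<in> P" and e: "0 < e"
    \<comment> \<open>With the same p and v, changing the coefficient from c to l moves the point by
      |l - c| times \<open>dist p v\<close>, at most |l - c| D. The margin e / D keeps this below e
      when c < l, also for negative c.\<close>
    have "ereal (l - e / D) < ereal l"
      using e D by simp
    also have "\<dots> \<le> vg_lambda P"
      using vg by (simp add: vertex_generated_def)
    finally obtain c where c: "l - e / D < c" and Pc: "P = vertex_mix c P"
      unfolding vg_lambda_def less_Sup_iff vertex_mix_def by auto
    obtain p v where pv: "p \<in> P" "v \<in> vertices P" and xc: "x = (1 - c) *\<^sub>R p + c *\<^sub>R v"
      using x Pc vertex_mixE by metis
    consider "c < l" | "l \<le> c" "c \<le> 1" | "1 < c"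
      by linarith
    then show "\<exists>y\<in>vertex_mix l P. dist x y < e"
    proof cases
      case 1
      have "x - ((1 - l) *\<^sub>R p + l *\<^sub>R v) = (l - c) *\<^sub>R (p - v)"
        by (simp add: xc algebra_simps)
      then have "dist x ((1 - l) *\<^sub>R p + l *\<^sub>R v) = (l - c) * dist p v"
        using 1 by (simp add: dist_norm)
      also have "\<dots> \<le> (l - c) * D"
        using 1 D pv vertices_subset[of P] by (intro mult_left_mono) auto
      also have "\<dots> < e"
        using c D by (simp add: field_simps)
      finally show ?thesis
        using pv vertex_mixI by blast
    next
      case 2
      then have "x \<in> vertex_mix l P"
        using vertex_mix_antimono[OF facts(1) l(1)] x Pc by blast
      then show ?thesis
        using e by (metis dist_self)
    next
      case 3
      then have "P = {v}"
        using vertex_mix_gt_one_imp_singleton[of c P v] Pc pv by blast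
      then have "x = (1 - l) *\<^sub>R v + l *\<^sub>R v"
        using x by (simp add: algebra_simps)
      then show ?thesis
        using e pv x \<open>P = {v}\<close> vertex_mixI[of v P v l] by (metis dist_self singletonI)
    qed
  qed
qed

text \<open>Non-emptiness of \<open>B\<close> excludes the default value 0 of \<open>infdist\<close>
  on the empty set.\<close>

lemma infdist_lessE:
  assumes "infdist a B < e" "B \<noteq> {}"
  obtains b where "b \<in> B" "dist a b < e"
proof -
  have "(INF b\<in>B. dist a b) < e"
    using assms by (simp add: infdist_def)
  then show ?thesis
    using that assms(2) by (auto simp: cInf_less_iff)
qed

lemma hausdorff_dist_commute: "hausdorff_dist A B = hausdorff_dist B A"
  by (simp add: hausdorff_dist_def max.commute)

text \<open>Finiteness of \<open>A\<close> bounds the family of distances, so that the real-valued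
  \<open>SUP\<close> is an upper bound.\<close>

lemma hausdorff_dist_lessE:
  assumes "hausdorff_dist A B < e" "finite A" "B \<noteq> {}" "a \<in> A"
  obtains b where "b \<in> B" "dist a b < e"
proof -
  have "infdist a B \<le> (SUP a\<in>A. infdist a B)"
    using assms by (intro cSUP_upper) auto
  also have "\<dots> < e"
    using assms by (simp add: hausdorff_dist_def)
  finally show ?thesis
    using infdist_lessE assms(3) that by blast
qed

text \<open>The open e-neighbourhood of \<open>convex hull B\<close> is a sum of two convex sets.
  Being convex and containing \<open>A\<close>, it contains the hull of \<open>A\<close>.\<close>

lemma convex_hull_near:
  fixes A :: "'a::real_normed_vector set"
  assumes near: "\<And>a. a \<in> A \<Longrightarrow> \<exists>b\<in>B. dist a b < e" and x: "x \<in> convex hull A"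
  shows "\<exists>y\<in>convex hull B. dist x y < e"
proof -
  let ?N = "{u + z |u z. u \<in> ball 0 e \<and> z \<in> convex hull B}"
  have "A \<subseteq> ?N"
  proof
    fix a assume "a \<in> A"
    then obtain b where "b \<in> B" "dist a b < e"
      using near by blast
    then have "a = (a - b) + b" "a - b \<in> ball 0 e" "b \<in> convex hull B"
      by (auto simp: dist_norm norm_minus_commute hull_inc)
    then show "a \<in> ?N"
      by blast
  qed
  \<comment> \<open>The nested unions are the form in which \<open>convex_sums\<close> states
    convexity.\<close>
  moreover have "?N = (\<Union>u\<in>ball 0 e. \<Union>z\<in>convex hull B. {u + z})"
    by blast
  then have "convex ?N"
    using convex_sums[OF convex_ball convex_convex_hull] by simp
  ultimately have "x \<in> ?N"
    using x hull_minimal[of A ?N convex] by blast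
  then obtain u z where "x = u + z" "norm u < e" "z \<in> convex hull B"
    by auto
  then show ?thesis
    by (intro bexI[of _ z]) (auto simp: dist_norm)
qed

lemma d_F_commute: "d_F P Q = d_F Q P"
  by (simp add: d_F_def hausdorff_dist_commute)

lemma d_F_vertex_near:
  fixes P Q :: "'a::euclidean_space set"
  assumes "is_polytope P" "is_polytope Q" "d_F P Q < e" "v \<in> vertices P"
  shows "\<exists>w\<in>vertices Q. dist v w < e"
  using assms is_polytope_facts[OF assms(1)] is_polytope_facts[OF assms(2)]
  by (metis d_F_def hausdorff_dist_lessE)

lemma d_F_near:
  fixes P Q :: "'a::euclidean_space set"
  assumes "is_polytope P" "is_polytope Q" "d_F P Q < e" "x \<in> P"
  shows "\<exists>y\<in>Q. dist x y < e"
  using convex_hull_near[OF d_F_vertex_near[OF assms(1-3)]] assms(4)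
    is_polytope_facts(5)[OF assms(1)] is_polytope_facts(5)[OF assms(2)]
  by metis

text \<open>The common core of both claims. A point x of \<open>P\<close> is moved to y in
  \<open>Q\<close>, y is split in \<open>vertex_mix l Q\<close>, and its two components are moved
  back to \<open>P\<close> and \<open>vertices P\<close>.\<close>

lemma vertex_generated_limit:
  fixes P :: "'a::euclidean_space set"
  assumes P: "is_polytope P" and l: "0 \<le> l" "l \<le> 1"
    and approx: "\<And>e. 0 < e \<Longrightarrow> \<exists>Q. is_polytope Q \<and> d_F P Q < e \<and> vertex_generated l Q"
  shows "vertex_generated l P"
  unfolding vertex_generated_iff[OF P l]
proof (rule subset_closedI)
  show "closed (vertex_mix l P)"
    by (intro compact_imp_closed compact_vertex_mix P)
  fix x and e :: real
  assume x: "x \<in> P" and "0 < e"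
  then obtain Q where Q: "is_polytope Q" and PQ: "d_F P Q < e / 2" and "vertex_generated l Q"
    using approx[of "e / 2"] by auto
  then have QQ: "Q \<subseteq> vertex_mix l Q" and QP: "d_F Q P < e / 2"
    using vertex_generated_iff[OF Q l] d_F_commute[of P Q] by auto
  obtain y where y: "y \<in> Q" "dist x y < e / 2"
    using d_F_near[OF P Q PQ x] by blast
  obtain q w where qw: "q \<in> Q" "w \<in> vertices Q" "y = (1 - l) *\<^sub>R q + l *\<^sub>R w"
    using y QQ vertex_mixE by blast
  obtain p where p: "p \<in> P" "dist q p < e / 2"
    using d_F_near[OF Q P QP qw(1)] by blast
  obtain v where v: "v \<in> vertices P" "dist w v < e / 2"
    using d_F_vertex_near[OF Q P QP qw(2)] by blast
  define z where "z = (1 - l) *\<^sub>R p + l *\<^sub>R v"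
  have "y - z = (1 - l) *\<^sub>R (q - p) + l *\<^sub>R (w - v)"
    by (simp add: qw z_def algebra_simps)
  then have "dist y z \<le> (1 - l) * dist q p + l * dist w v"
    using l norm_triangle_ineq[of "(1 - l) *\<^sub>R (q - p)" "l *\<^sub>R (w - v)"]
    by (simp add: dist_norm)
  \<comment> \<open>The weights 1 - l and l are nonnegative with sum 1, so the two errors average
    instead of adding up.\<close>
  also have "\<dots> \<le> e / 2"
    using p v l by (intro convex_bound_le) auto
  finally have "dist x z < e"
    using y dist_triangle[of x z y] by linarith
  then show "\<exists>z\<in>vertex_mix l P. dist x z < e"
    using vertex_mixI[OF p(1) v(1)] unfolding z_def by blast
qed

theorem proposition4p4:
  fixes l :: real
  assumes "l \<in> {1 / (real CARD('n::finite) + 1) .. 1 / 2}"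
  shows "(\<forall>P :: (real ^ 'n) set. is_polytope P \<and> \<not> vertex_generated l P \<longrightarrow>
            (\<exists>\<epsilon>>0. \<forall>Q :: (real ^ 'n) set. is_polytope Q \<and> d_F P Q < \<epsilon> \<longrightarrow>
               \<not> vertex_generated l Q))
       \<and> (\<forall>(P :: (real ^ 'n) set) (Pm :: nat \<Rightarrow> (real ^ 'n) set).
            is_polytope P \<and> (\<forall>m\<ge>1. is_polytope (Pm m)) \<and> (\<forall>m\<ge>1. Pm m \<in> VG l) \<and>
            (\<lambda>m. d_F (Pm m) P) \<longlonglongrightarrow> 0 \<longrightarrow> P \<in> VG l)"
proof -
  have l: "0 \<le> l" "l \<le> 1"
    using assms by (auto intro: order_trans[of 0 "1 / (real CARD('n) + 1)"])
  show ?thesis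
  proof (intro conjI allI impI; elim conjE)
    fix P :: "(real ^ 'n) set"
    assume "is_polytope P" "\<not> vertex_generated l P"
    then show "\<exists>\<epsilon>>0. \<forall>Q :: (real ^ 'n) set. is_polytope Q \<and> d_F P Q < \<epsilon> \<longrightarrow>
        \<not> vertex_generated l Q"
      \<comment> \<open>If no radius worked, every e > 0 would admit a vertex generated
        \<open>Q\<close> within e of \<open>P\<close>.\<close>
      using vertex_generated_limit[OF _ l] by blast
  next
    fix P :: "(real ^ 'n) set" and Pm :: "nat \<Rightarrow> (real ^ 'n) set"
    assume P: "is_polytope P" and Pm: "\<forall>m\<ge>1. Pm m \<in> VG l"
      and lim: "(\<lambda>m. d_F (Pm m) P) \<longlonglongrightarrow> 0"
    have "\<exists>Q. is_polytope Q \<and> d_F P Q < e \<and> vertex_generated l Q" if "0 < e" for e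
    proof -
      \<comment> \<open>The bound \<open>1 \<le> m\<close> is carried along because
        \<open>Pm 0\<close> is unconstrained.\<close>
      have "\<forall>\<^sub>F m in sequentially. d_F (Pm m) P < e \<and> 1 \<le> m"
        using order_tendstoD(2)[OF lim that] eventually_ge_at_top by (rule eventually_conj)
      then obtain m where "d_F (Pm m) P < e" "1 \<le> m"
        using eventually_happens by fastforce
      then show ?thesis
        using Pm d_F_commute[of P] unfolding VG_def by auto
    qed
    then show "P \<in> VG l"
      using P vertex_generated_limit[OF P l] by (simp add: VG_def)
  qed
qed

end
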